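(* Let $m\ge 1$ and let $\{A(k)\}_{k\ge 0}$ be a chain of $m\times m$ stochastic matrices. If $\{A(k)\}$ is ergodic, then $\{A(k)\}$ has the absolute infinite flow property.
   Context: $[m]=\{1,\dots,m\}$; $S\subset[m]$ denotes a proper subset, and $\bar S=[m]\setminus S$. A matrix is stochastic if its entries are nonnegative and each row sums to $1$; a stochastic chain is a sequence $\{A(k)\}_{k\ge0}$ of stochastic $m\times m$ matrices. A vector is stochastic if its entries are nonnegative and sum to $1$; $e$ is the all-ones column vector. For $k>s\ge 0$, $A(k:s)=A(k-1)A(k-2)\cdots A(s)$. The chain $\{A(k)\}$ is ergodic if for every $s\ge0$ there is a stochastic vector $v(s)$ with $\lim_{k\to\infty}A(k:s)=e\,v(s)^T$. A sequence $\{S(k)\}_{k\ge0}$ of sets $S(k)\subset[m]$ is regular if $|S(k)|=|S(0)|\neq 0$ for all $k\ge 0$. For a regular sequence define $$A_{S(k+1),S(k)}(k)=\sum_{i\in S(k+1),\,j\in\bar S(k)}A_{ij}(k)+\sum_{i\in\bar S(k+1),\,j\in S(k)}A_{ij}(k),\qquad F(\{A(k)\};\{S(k)\})=\sum_{k=0}^\infty A_{S(k+1),S(k)}(k).$$ The chain $\{A(k)\}$ has the absolute infinite flow property if $F(\{A(k)\};\{S(k)\})=\infty$ for every regular sequence $\{S(k)\}$. *)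

theory Defs
  imports "HOL-Analysis.Analysis"
begin

text \<open>
  The index set [m] with m \<ge> 1 is a type \<open>'m\<close> of class \<open>finite\<close>, so \<open>UNIV\<close> plays the role of [m]
  and \<open>- S\<close> is the complement of S. An m \<times> m matrix is \<open>real^'m^'m\<close>, with (i,j) entry \<open>M $ i $ j\<close>.
\<close>

definition stochastic_vector :: "real^'m \<Rightarrow> bool" where
  "stochastic_vector v \<longleftrightarrow> (\<forall>i. 0 \<le> v $ i) \<and> (\<Sum>i\<in>UNIV. v $ i) = 1"

definition stochastic_matrix :: "real^'m^'m \<Rightarrow> bool" where
  "stochastic_matrix M \<longleftrightarrow> (\<forall>i j. 0 \<le> M $ i $ j) \<and> (\<forall>i. (\<Sum>j\<in>UNIV. M $ i $ j) = 1)"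

definition stochastic_chain :: "(nat \<Rightarrow> real^'m^'m) \<Rightarrow> bool" where
  "stochastic_chain A \<longleftrightarrow> (\<forall>k. stochastic_matrix (A k))"

text \<open>
  For k > s, \<open>backward_product A k s\<close> is A(k:s) = A(k-1) A(k-2) ... A(s).
  For k \<le> s it is the identity matrix (the empty product).
\<close>

primrec backward_product :: "(nat \<Rightarrow> real^'m^'m) \<Rightarrow> nat \<Rightarrow> nat \<Rightarrow> real^'m^'m" where
  "backward_product A 0 s = mat 1"
| "backward_product A (Suc k) s = (if s \<le> k then A k ** backward_product A k s else mat 1)"

text \<open>
  The limit matrix is e v^T, where e is the all-ones column vector and v^T is the transpose of v:
  its (i,j) entry is 1 * v(j).
\<close>

definition ergodic :: "(nat \<Rightarrow> real^'m^'m) \<Rightarrow> bool" where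
  "ergodic A \<longleftrightarrow>
     (\<forall>s. \<exists>v. stochastic_vector v \<and>
        (\<lambda>k. backward_product A k s) \<longlonglongrightarrow> (\<chi> i j. v $ j))"

text \<open>The members of a regular sequence are \<^emph>\<open>proper\<close> subsets of the index set.\<close>

definition regular_sequence :: "(nat \<Rightarrow> 'm::finite set) \<Rightarrow> bool" where
  "regular_sequence S \<longleftrightarrow> (\<forall>k. S k \<subset> UNIV \<and> card (S k) = card (S 0)) \<and> card (S 0) \<noteq> 0"

text \<open>\<open>cross_flow M T S\<close>, with \<open>M\<close> = A(k), \<open>T\<close> = S(k+1), \<open>S\<close> = S(k), is the flow at time k.\<close>

definition cross_flow :: "real^'m^'m \<Rightarrow> 'm set \<Rightarrow> 'm set \<Rightarrow> real" where
  "cross_flow M T S = (\<Sum>i\<in>T. \<Sum>j\<in>- S. M $ i $ j) + (\<Sum>i\<in>- T. \<Sum>j\<in>S. M $ i $ j)"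

definition total_flow :: "(nat \<Rightarrow> real^'m^'m) \<Rightarrow> (nat \<Rightarrow> 'm set) \<Rightarrow> ereal" where
  "total_flow A S = (\<Sum>k. ereal (cross_flow (A k) (S (Suc k)) (S k)))"

definition absolute_infinite_flow :: "(nat \<Rightarrow> real^'m^'m) \<Rightarrow> bool" where
  "absolute_infinite_flow A \<longleftrightarrow> (\<forall>S. regular_sequence S \<longrightarrow> total_flow A S = \<infinity>)"

end

theory Submission
  imports Defs
begin

text \<open>
  If the total flow of some regular sequence \<open>S\<close> were finite, its tail from some time \<open>s\<close> on would be
  smaller than \<open>1/4\<close>. Run the chain from time \<open>s\<close> on the indicator vector of \<open>S s\<close>, that is, consider
  \<open>x k = A(k:s) 1\<^bsub>S s\<^esub>\<close>. A stochastic matrix does not increase the sup-norm, and it maps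
  \<open>1\<^bsub>S k\<^esub>\<close> to \<open>1\<^bsub>S (k + 1)\<^esub>\<close> up to a sup-norm error of at most the flow at time \<open>k\<close>. The errors
  add up, so \<open>x k\<close> stays within \<open>1/4\<close> of \<open>1\<^bsub>S k\<^esub>\<close> at all times (\<open>backward_product_tracks_indicator\<close>).
  Since \<open>S k\<close> is neither empty nor everything, \<open>x k\<close> then always has two entries more than \<open>1/2\<close>
  apart. But ergodicity makes all entries of \<open>x k\<close> converge to the same number.
\<close>

abbreviation indicator_vec :: "'m set \<Rightarrow> real^'m" where
  "indicator_vec S \<equiv> (\<chi> j. indicator S j)"

lemma cross_flow_nonneg:
  assumes "stochastic_matrix M"
  shows "0 \<le> cross_flow M T S"
  using assms by (auto simp: cross_flow_def stochastic_matrix_def intro!: add_nonneg_nonneg sum_nonneg)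

text \<open>
  The error in row \<open>i\<close> is the mass that the row puts on the wrong side of the partition: on \<open>- S\<close> if
  \<open>i \<in> T\<close>, on \<open>S\<close> otherwise. This is one row of one of the two blocks summed in the flow.
\<close>

lemma indicator_error_le_cross_flow:
  fixes M :: "real^'m^'m"
  assumes "stochastic_matrix M"
  shows "\<bar>(M *v indicator_vec S) $ i - indicator T i\<bar> \<le> cross_flow M T S"
proof -
  have nonneg: "\<And>i j. 0 \<le> M $ i $ j" and row: "(\<Sum>j\<in>UNIV. M $ i $ j) = 1"
    using assms by (auto simp: stochastic_matrix_def)
  have blocks: "0 \<le> (\<Sum>i\<in>U. \<Sum>j\<in>V. M $ i $ j)" for U V
    by (intro sum_nonneg nonneg)
  have row_le: "(\<Sum>j\<in>V. M $ i $ j) \<le> (\<Sum>i\<in>U. \<Sum>j\<in>V. M $ i $ j)" if "i \<in> U" for U V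
    using that by (intro member_le_sum[of i U "\<lambda>i. \<Sum>j\<in>V. M $ i $ j"]) (auto intro!: sum_nonneg nonneg)
  have image: "(M *v indicator_vec S) $ i = (\<Sum>j\<in>S. M $ i $ j)"
    by (simp add: matrix_vector_mult_def indicator_def if_distrib sum.If_cases cong: if_cong)
  have split: "(\<Sum>j\<in>S. M $ i $ j) + (\<Sum>j\<in>- S. M $ i $ j) = 1"
    using row sum.subset_diff[of S UNIV "\<lambda>j. M $ i $ j"] by (simp add: Compl_eq_Diff_UNIV)
  have pos: "0 \<le> (\<Sum>j\<in>V. M $ i $ j)" for V
    by (intro sum_nonneg nonneg)
  show ?thesis
  proof (cases "i \<in> T")
    case True
    then show ?thesis
      using row_le[of T "- S"] blocks[where U = "- T" and V = S] split pos[of "- S"]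
      by (simp add: image cross_flow_def)
  next
    case False
    then show ?thesis
      using row_le[of "- T" S] blocks[where U = T and V = "- S"] pos[of S]
      by (simp add: image cross_flow_def)
  qed
qed

lemma stochastic_matrix_sup_norm_contraction:
  fixes M :: "real^'m^'m"
  assumes "stochastic_matrix M" and "\<And>j. \<bar>y $ j\<bar> \<le> \<epsilon>"
  shows "\<bar>(M *v y) $ i\<bar> \<le> \<epsilon>"
proof -
  have "\<bar>(M *v y) $ i\<bar> \<le> (\<Sum>j\<in>UNIV. \<bar>M $ i $ j * y $ j\<bar>)"
    by (simp add: matrix_vector_mult_def)
  also have "\<dots> \<le> (\<Sum>j\<in>UNIV. M $ i $ j * \<epsilon>)"
    using assms by (intro sum_mono) (auto simp: stochastic_matrix_def abs_mult intro!: mult_left_mono)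
  also have "\<dots> = \<epsilon>"
    using assms(1) by (simp add: stochastic_matrix_def flip: sum_distrib_right)
  finally show ?thesis .
qed

text \<open>
  Each step adds one new error and, by contraction, does not amplify the errors made before.
\<close>

lemma backward_product_tracks_indicator:
  fixes A :: "nat \<Rightarrow> real^'m^'m"
  assumes "stochastic_chain A" and "s \<le> k"
  shows "\<bar>(backward_product A k s *v indicator_vec (S s)) $ i - indicator (S k) i\<bar>
    \<le> (\<Sum>t=s..<k. cross_flow (A t) (S (Suc t)) (S t))"
  using assms(2)
proof (induction k arbitrary: i rule: dec_induct)
  case base
  have "backward_product A s s = mat 1"
    by (cases s) auto
  then show ?case
    by simp
next
  case (step k)
  let ?x = "backward_product A k s *v indicator_vec (S s)"
  let ?E = "\<Sum>t=s..<k. cross_flow (A t) (S (Suc t)) (S t)"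
  have stoch: "stochastic_matrix (A k)"
    using assms(1) by (simp add: stochastic_chain_def)
  have next_x: "backward_product A (Suc k) s *v indicator_vec (S s) = A k *v ?x"
    using step.hyps by (simp add: matrix_vector_mul_assoc)
  have decomposition: "(A k *v ?x) $ i - indicator (S (Suc k)) i
      = (A k *v (?x - indicator_vec (S k))) $ i
        + ((A k *v indicator_vec (S k)) $ i - indicator (S (Suc k)) i)"
    by (simp add: matrix_vector_mult_diff_distrib)
  have "\<bar>(A k *v (?x - indicator_vec (S k))) $ i\<bar> \<le> ?E"
    using step.IH by (intro stochastic_matrix_sup_norm_contraction[OF stoch]) simp
  moreover have "\<bar>(A k *v indicator_vec (S k)) $ i - indicator (S (Suc k)) i\<bar>
      \<le> cross_flow (A k) (S (Suc k)) (S k)"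
    by (rule indicator_error_le_cross_flow[OF stoch])
  ultimately show ?case
    using step.hyps unfolding next_x decomposition by simp
qed

lemma ergodic_entries_tendsto_common_limit:
  fixes A :: "nat \<Rightarrow> real^'m^'m"
  assumes "ergodic A"
  obtains c where "\<And>i. (\<lambda>k. (backward_product A k s *v y) $ i) \<longlonglongrightarrow> c"
proof -
  obtain v where v: "(\<lambda>k. backward_product A k s) \<longlonglongrightarrow> (\<chi> i j. v $ j)"
    using assms unfolding ergodic_def by blast
  have "(\<lambda>k. backward_product A k s $ i $ j) \<longlonglongrightarrow> v $ j" for i j
    using tendsto_vec_nth[OF tendsto_vec_nth[OF v], of i j] by simp
  then have "(\<lambda>k. (backward_product A k s *v y) $ i) \<longlonglongrightarrow> (\<Sum>j\<in>UNIV. v $ j * y $ j)" for i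
    unfolding matrix_vector_mult_def vec_lambda_beta
    by (intro tendsto_sum tendsto_mult tendsto_const)
  then show ?thesis
    by (rule that)
qed

theorem theorem2:
  fixes A :: "nat \<Rightarrow> real^'m^'m"
  assumes "stochastic_chain A"
    and "ergodic A"
  shows "absolute_infinite_flow A"
  unfolding absolute_infinite_flow_def
proof (intro allI impI, rule ccontr)
  fix S :: "nat \<Rightarrow> 'm set"
  assume regular: "regular_sequence S" and finite_flow: "total_flow A S \<noteq> \<infinity>"
  define f where "f k = cross_flow (A k) (S (Suc k)) (S k)" for k
  have "0 \<le> f k" for k
    using assms(1) by (auto simp: f_def stochastic_chain_def intro: cross_flow_nonneg)
  then have "summable f"
    using finite_flow by (intro summable_ereal) (auto simp: total_flow_def f_def)
  then obtain s where tail: "\<And>k. norm (sum f {s..<k}) < 1/4"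
    unfolding summable_Cauchy by (metis order.refl zero_less_divide_1_iff zero_less_numeral)
  define x where "x k = backward_product A k s *v indicator_vec (S s)" for k
  have near: "\<bar>x k $ i - indicator (S k) i\<bar> < 1/4" if "s \<le> k" for k i
    using backward_product_tracks_indicator[OF assms(1) that, of S i] tail[of k]
    by (simp add: x_def f_def)
  obtain c where "\<And>i. (\<lambda>k. x k $ i) \<longlonglongrightarrow> c"
    unfolding x_def using ergodic_entries_tendsto_common_limit[OF assms(2)] by metis
  then have "\<forall>\<^sub>F k in sequentially. \<forall>i. dist (x k $ i) c < 1/4"
    by (intro eventually_all_finite tendstoD) auto
  then have "\<forall>\<^sub>F k in sequentially. s \<le> k \<and> (\<forall>i. dist (x k $ i) c < 1/4)"
    using eventually_ge_at_top[of s] by eventually_elim simp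
  then obtain k where k: "s \<le> k" "\<And>i. dist (x k $ i) c < 1/4"
    by (auto dest: eventually_happens)
  have "S k \<noteq> {}" "S k \<noteq> UNIV"
    using regular unfolding regular_sequence_def by (metis card.empty, blast)
  then obtain i i' where "i \<in> S k" "i' \<notin> S k"
    by blast
  then have "\<bar>x k $ i - 1\<bar> < 1/4" "\<bar>x k $ i'\<bar> < 1/4"
    using near[OF k(1), of i] near[OF k(1), of i'] by simp_all
  then show False
    using k(2)[of i] k(2)[of i'] unfolding dist_real_def by linarith
qed

end
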